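(* Let $A$ be an $m\times m$ matrix with real coefficients and let $\widehat{F}_A:\mathbb{R}^m\to\mathbb{R}^m$, $\widehat{F}_A(x)=x+A(x^3)$. Let $V\subset\mathbb{R}^m$ be a vector subspace containing $\mathrm{Ker}(A)^{1/3}$. Let $x_\infty\in V$ be a vector all of whose coordinates are non-zero. Then the following two conditions are equivalent: 1) There is a sequence $x_n\in V$ such that $\|x_n\|\to\infty$, $\widehat{F}_A(x_n)$ is bounded, and $x_n/\|x_n\|\to x_\infty/\|x_\infty\|$. 2) $x_\infty\in A(V*x_\infty^2)\cap \mathrm{Ker}(A)^{1/3}$.
   Context: For $x,y\in\mathbb{R}^m$, $x*y=(x_1y_1,\ldots,x_my_m)$ is the coordinatewise product, $x^2=x*x$, $x^3=x*x*x$. For a subset $B\subset\mathbb{R}^m$, $B^{1/3}=\{x\in\mathbb{R}^m: x^3\in B\}$. For a subspace $V$ and a vector $y$, $V*y=\{v*y:v\in V\}$. $\mathrm{Ker}(A)=\{x:Ax=0\}$. *)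

theory Defs
  imports "HOL-Analysis.Analysis"
begin

(* The ring structure on real ^ 'n in HOL-Analysis is the coordinatewise one, so x * y is the
   coordinatewise product of vectors and x ^ 2, x ^ 3 are coordinatewise powers. *)

definition Ker :: "real ^ 'n ^ 'n \<Rightarrow> (real ^ 'n) set" where
  "Ker A = {x. A *v x = 0}"

definition cube_root_set :: "(real ^ 'n) set \<Rightarrow> (real ^ 'n) set" where
  "cube_root_set B = {x. x ^ 3 \<in> B}"

definition mult_set :: "(real ^ 'n) set \<Rightarrow> real ^ 'n \<Rightarrow> (real ^ 'n) set" where
  "mult_set V y = {v * y |v. v \<in> V}"

definition F_hat :: "real ^ 'n ^ 'n \<Rightarrow> real ^ 'n \<Rightarrow> real ^ 'n" where
  "F_hat A x = x + A *v (x ^ 3)"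

end

theory Submission
  imports Defs
begin

text \<open>
  Let the sequence \<open>x n\<close> escape to infinity in the direction \<open>u\<close> with \<open>F_hat A (x n)\<close> bounded. Dividing
  by \<open>norm (x n) ^ 3\<close> gives \<open>A *v u ^ 3 = 0\<close>. For the other condition, split \<open>x n ^ 3 = k n + r n\<close>
  with \<open>k n\<close> in the kernel of \<open>A\<close> and \<open>r n = L (A *v x n ^ 3)\<close> of order \<open>norm (x n)\<close>, where \<open>L\<close> is a
  linear generalized inverse of \<open>A\<close>. The coordinatewise cube root \<open>y n\<close> of \<open>k n\<close> lies in \<open>V\<close>, and
  \<open>r n = (x n - y n) * (x n ^ 2 + x n * y n + y n ^ 2)\<close>. As \<open>u\<close> has no zero coordinate,
  \<open>norm (x n) *\<^sub>R (x n - y n)\<close> converges, to a vector \<open>w'\<close> of \<open>V\<close> with \<open>A *v (3 *\<^sub>R w' * u ^ 2) = - u\<close>.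
  Conversely, such vectors \<open>u\<close> and \<open>w'\<close> make the sequence \<open>n *\<^sub>R u + (1 / n) *\<^sub>R w'\<close> work: the terms of
  order \<open>n ^ 3\<close> and \<open>n\<close> of \<open>F_hat A\<close> cancel.
\<close>

lemma vec_power_component: "((x :: 'a::monoid_mult ^ 'n) ^ k) $ i = (x $ i) ^ k"
  by (induction k) simp_all

lemma scaleR_vec_power:
  fixes x :: "real ^ 'n"
  shows "(c *\<^sub>R x) ^ k = (c ^ k) *\<^sub>R x ^ k"
  by (simp add: vec_eq_iff vec_power_component power_mult_distrib)

lemma tendsto_vec_power:
  fixes f :: "'a \<Rightarrow> real ^ 'n"
  assumes "(f \<longlongrightarrow> l) F"
  shows "((\<lambda>x. f x ^ k) \<longlongrightarrow> l ^ k) F"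
  by (rule vec_tendstoI) (auto simp: vec_power_component intro!: tendsto_intros assms)

lemma linear_tendsto:
  fixes f :: "'a::euclidean_space \<Rightarrow> 'b::real_normed_vector"
  assumes "linear f" and "(g \<longlongrightarrow> l) F"
  shows "((\<lambda>x. f (g x)) \<longlongrightarrow> f l) F"
  using assms by (simp add: linear_conv_bounded_linear bounded_linear.tendsto)

text \<open>Scalars can be absorbed into \<open>V\<close>: this carries the equation found for the
  normalized direction, with its sign, back to the vector itself.\<close>

lemma mem_image_mult_set_scaleR:
  assumes V: "subspace V" and w: "w \<in> V" and c: "c \<noteq> 0"
    and eq: "A *v (w * (d *\<^sub>R x) ^ 2) = c *\<^sub>R x"
  shows "x \<in> ((*v) A) ` mult_set V (x ^ 2)"
proof -
  let ?v = "(d\<^sup>2 / c) *\<^sub>R w"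
  have "?v * x ^ 2 = (1 / c) *\<^sub>R (w * (d *\<^sub>R x) ^ 2)"
    by (simp add: vec_eq_iff vec_power_component power_mult_distrib)
  then have "A *v (?v * x ^ 2) = (1 / c) *\<^sub>R (A *v (w * (d *\<^sub>R x) ^ 2))"
    by (simp add: matrix_vector_mult_scaleR)
  also have "\<dots> = x" using c by (simp add: eq)
  finally have "A *v (?v * x ^ 2) = x" .
  moreover have "?v \<in> V" using V w by (simp add: subspace_scale)
  ultimately show ?thesis unfolding mult_set_def by (intro image_eqI[where x = "?v * x ^ 2"] CollectI) metis+
qed

lemma escaping_sequence_limit:
  fixes A :: "real ^ 'n ^ 'n" and u :: "real ^ 'n"
  assumes V: "subspace V" and KV: "cube_root_set (Ker A) \<subseteq> V"
    and u: "\<And>i. u $ i \<noteq> 0"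
    and xV: "\<And>n. x n \<in> V"
    and x_top: "filterlim (\<lambda>n. norm (x n)) at_top sequentially"
    and F_bdd: "bounded (range (\<lambda>n. F_hat A (x n)))"
    and lim: "(\<lambda>n. x n /\<^sub>R norm (x n)) \<longlonglongrightarrow> u"
  shows "A *v (u ^ 3) = 0" and "\<exists>w\<in>V. A *v (w * u ^ 2) = - u"
proof -
  define s where "s n = inverse (norm (x n))" for n
  have s0: "s \<longlonglongrightarrow> 0"
    unfolding s_def by (rule tendsto_inverse_0_at_top[OF x_top])
  have s_nz: "eventually (\<lambda>n. s n \<noteq> 0) sequentially"
    using filterlim_at_top_dense[THEN iffD1, OF x_top, rule_format, of 0]
    by eventually_elim (simp add: s_def)
  have su: "(\<lambda>n. s n *\<^sub>R x n) \<longlonglongrightarrow> u"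
    using lim by (simp add: s_def)
  obtain B where B: "\<And>n. norm (F_hat A (x n)) \<le> B"
    using F_bdd by (auto simp: bounded_iff)
  have sF: "(\<lambda>n. s n *\<^sub>R F_hat A (x n)) \<longlonglongrightarrow> 0"
  proof (rule Lim_null_comparison)
    show "eventually (\<lambda>n. norm (s n *\<^sub>R F_hat A (x n)) \<le> \<bar>s n\<bar> * B) sequentially"
      using B by (intro always_eventually allI) (simp add: mult_left_mono)
    show "(\<lambda>n. \<bar>s n\<bar> * B) \<longlonglongrightarrow> 0"
      using tendsto_mult_right[OF tendsto_rabs[OF s0], of B] by simp
  qed
  have A_cube: "A *v (x n ^ 3) = F_hat A (x n) - x n" for n
    by (simp add: F_hat_def)
  \<comment> \<open>Boundedness forces \<open>A *v (x n ^ 3)\<close> to cancel \<open>x n\<close> up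
    to a bounded error, so it grows only like \<open>norm (x n)\<close>, not like its cube.\<close>
  have sA: "(\<lambda>n. s n *\<^sub>R (A *v (x n ^ 3))) \<longlonglongrightarrow> - u"
    unfolding A_cube scaleR_diff_right using tendsto_diff[OF sF su] by simp
  have linA: "linear ((*v) A)" by simp

  \<comment> \<open>Cubing produces two more factors \<open>s n\<close> than \<open>sA\<close>
    needs, so the limit is 0.\<close>
  have "(\<lambda>n. A *v ((s n *\<^sub>R x n) ^ 3)) \<longlonglongrightarrow> A *v (u ^ 3)"
    by (rule linear_tendsto[OF linA tendsto_vec_power[OF su]])
  moreover have "A *v ((s n *\<^sub>R x n) ^ 3) = (s n)\<^sup>2 *\<^sub>R (s n *\<^sub>R (A *v (x n ^ 3)))" for n
    by (simp add: scaleR_vec_power matrix_vector_mult_scaleR eval_nat_numeral mult.assoc)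
  moreover have "(\<lambda>n. (s n)\<^sup>2 *\<^sub>R (s n *\<^sub>R (A *v (x n ^ 3)))) \<longlonglongrightarrow> 0\<^sup>2 *\<^sub>R (- u)"
    by (intro tendsto_intros s0 sA)
  ultimately have "A *v (u ^ 3) = 0\<^sup>2 *\<^sub>R (- u)"
    by (simp only: LIMSEQ_unique)
  then show "A *v (u ^ 3) = 0"
    by simp

  obtain L where linL: "linear L" and L: "\<And>v. A *v L (A *v v) = A *v v"
    using linear_exists_right_inverse_on[OF linA subspace_UNIV] by auto
  define r where "r n = L (A *v (x n ^ 3))" for n
  \<comment> \<open>\<open>root 3\<close> is an odd root, exact on negative reals too, so no sign
    condition arises.\<close>
  define y :: "nat \<Rightarrow> real ^ 'n" where "y n = (\<chi> i. root 3 ((x n ^ 3 - r n) $ i))" for n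
  have y_cube: "y n ^ 3 = x n ^ 3 - r n" for n
    by (simp add: vec_eq_iff vec_power_component y_def odd_real_root_pow)
  have yV: "y n \<in> V" for n
    using KV by (auto simp: cube_root_set_def Ker_def y_cube r_def matrix_vector_mult_diff_distrib L)
  define \<rho> where "\<rho> = L (- u)"
  \<comment> \<open>Linearity of \<open>L\<close> gives continuity, so the linear growth of
    \<open>A *v (x n ^ 3)\<close> passes to \<open>r n\<close>.\<close>
  have sr: "(\<lambda>n. s n *\<^sub>R r n) \<longlonglongrightarrow> \<rho>"
    using linear_tendsto[OF linL sA] by (simp add: r_def \<rho>_def linear_cmul[OF linL])
  have A_rho: "A *v \<rho> = - u"
  proof (rule LIMSEQ_unique)
    show "(\<lambda>n. A *v (s n *\<^sub>R r n)) \<longlonglongrightarrow> A *v \<rho>"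
      by (rule linear_tendsto[OF linA sr])
    show "(\<lambda>n. A *v (s n *\<^sub>R r n)) \<longlonglongrightarrow> - u"
      using sA by (simp add: r_def matrix_vector_mult_scaleR L)
  qed

  \<comment> \<open>After scaling, the cubes of \<open>x n\<close> and \<open>y n\<close> differ by
    a null sequence; \<open>root 3\<close> is continuous.\<close>
  have sy: "(\<lambda>n. s n *\<^sub>R y n) \<longlonglongrightarrow> u"
  proof (rule vec_tendstoI)
    fix i
    have "(\<lambda>n. ((s n *\<^sub>R x n) ^ 3 - (s n)\<^sup>2 *\<^sub>R (s n *\<^sub>R r n)) $ i) \<longlonglongrightarrow> (u ^ 3 - 0\<^sup>2 *\<^sub>R \<rho>) $ i"
      by (intro tendsto_intros tendsto_vec_power su s0 sr)
    moreover have "(s n *\<^sub>R x n) ^ 3 - (s n)\<^sup>2 *\<^sub>R (s n *\<^sub>R r n) = (s n *\<^sub>R y n) ^ 3" for n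
      unfolding scaleR_vec_power y_cube
      by (simp add: scaleR_diff_right power2_eq_square power3_eq_cube mult.assoc)
    ultimately have "(\<lambda>n. ((s n *\<^sub>R y n) ^ 3) $ i) \<longlonglongrightarrow> (u ^ 3 - 0\<^sup>2 *\<^sub>R \<rho>) $ i"
      by (simp only:)
    then have "(\<lambda>n. root 3 ((s n * y n $ i) ^ 3)) \<longlonglongrightarrow> root 3 ((u $ i) ^ 3)"
      by (intro tendsto_real_root) (simp add: vec_power_component)
    then show "(\<lambda>n. (s n *\<^sub>R y n) $ i) \<longlonglongrightarrow> u $ i"
      by (simp add: odd_real_root_power_cancel)
  qed

  \<comment> \<open>Here \<open>inverse (s n)\<close> is \<open>norm (x n)\<close>. The candidate
    limit \<open>w'\<close> solves the linearized equation
    \<open>3 *\<^sub>R w' * u ^ 2 = \<rho>\<close>.\<close>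
  define w where "w n = inverse (s n) *\<^sub>R (x n - y n)" for n
  define w' :: "real ^ 'n" where "w' = (\<chi> i. \<rho> $ i / (3 * (u $ i)\<^sup>2))"
  have wV: "w n \<in> V" for n
    using V xV yV by (simp add: w_def subspace_scale subspace_diff)
  have "w \<longlonglongrightarrow> w'"
  proof (rule vec_tendstoI)
    fix i
    \<comment> \<open>The rescaled cofactor of \<open>x n - y n\<close> in the difference of cubes.
      Its limit is nonzero because \<open>u $ i\<close> is, which permits the division.\<close>
    define d where "d n = (s n * x n $ i)\<^sup>2 + (s n * x n $ i) * (s n * y n $ i) + (s n * y n $ i)\<^sup>2" for n
    have sx_i: "(\<lambda>n. s n * x n $ i) \<longlonglongrightarrow> u $ i" and sy_i: "(\<lambda>n. s n * y n $ i) \<longlonglongrightarrow> u $ i"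
      and sr_i: "(\<lambda>n. s n * r n $ i) \<longlonglongrightarrow> \<rho> $ i"
      using tendsto_vec_nth[OF su, of i] tendsto_vec_nth[OF sy, of i] tendsto_vec_nth[OF sr, of i]
      by simp_all
    have "d \<longlonglongrightarrow> (u $ i)\<^sup>2 + u $ i * u $ i + (u $ i)\<^sup>2"
      unfolding d_def by (intro tendsto_intros sx_i sy_i)
    then have d: "d \<longlonglongrightarrow> 3 * (u $ i)\<^sup>2"
      by (simp add: power2_eq_square)
    have d_nz: "eventually (\<lambda>n. d n \<noteq> 0) sequentially"
      by (rule tendsto_imp_eventually_ne[OF d]) (use u in simp)
    have "(\<lambda>n. s n * r n $ i / d n) \<longlonglongrightarrow> \<rho> $ i / (3 * (u $ i)\<^sup>2)"
      by (intro tendsto_intros sr_i d) (use u in simp)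
    moreover have "eventually (\<lambda>n. s n * r n $ i / d n = w n $ i) sequentially"
      using s_nz d_nz
    proof eventually_elim
      case (elim n)
      have "r n = x n ^ 3 - y n ^ 3" by (simp add: y_cube)
      then have "r n $ i = (x n $ i) ^ 3 - (y n $ i) ^ 3"
        by (simp add: vec_power_component)
      also have "\<dots> = (x n $ i - y n $ i) * ((x n $ i)\<^sup>2 + x n $ i * y n $ i + (y n $ i)\<^sup>2)"
        by (simp add: algebra_simps eval_nat_numeral)
      also have "(s n)\<^sup>2 * \<dots> = (x n $ i - y n $ i) * d n"
        by (simp add: d_def power2_eq_square algebra_simps)
      finally have "(s n)\<^sup>2 * r n $ i = (x n $ i - y n $ i) * d n" .
      with elim show ?case
        by (simp add: w_def field_simps power2_eq_square)
    qed
    ultimately show "(\<lambda>n. w n $ i) \<longlonglongrightarrow> w' $ i"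
      by (simp add: w'_def tendsto_cong)
  qed
  \<comment> \<open>A subspace of a finite-dimensional space is closed.\<close>
  then have w'V: "w' \<in> V"
    using closed_sequentially[OF closed_subspace[OF V]] wV by blast
  have "(3 *\<^sub>R w') * u ^ 2 = \<rho>"
    using u by (simp add: vec_eq_iff vec_power_component w'_def)
  then have "A *v ((3 *\<^sub>R w') * u ^ 2) = - u"
    by (simp only: A_rho)
  with w'V V show "\<exists>w\<in>V. A *v (w * u ^ 2) = - u"
    using subspace_scale by blast
qed

lemma escaping_sequence_exists:
  fixes A :: "real ^ 'n ^ 'n" and u :: "real ^ 'n"
  assumes V: "subspace V" and uV: "u \<in> V" and u: "u \<noteq> 0" and wV: "w \<in> V"
    and ker: "A *v (u ^ 3) = 0" and Aw: "3 *\<^sub>R (A *v (w * u ^ 2)) = - u"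
  shows "\<exists>x :: nat \<Rightarrow> real ^ 'n.
            (\<forall>n. x n \<in> V)
          \<and> filterlim (\<lambda>n. norm (x n)) at_top sequentially
          \<and> bounded (range (\<lambda>n. F_hat A (x n)))
          \<and> (\<lambda>n. x n /\<^sub>R norm (x n)) \<longlonglongrightarrow> u /\<^sub>R norm u"
proof -
  \<comment> \<open>Starting at 1 makes \<open>e n\<close> a true inverse of \<open>t n\<close> for
    every \<open>n\<close>.\<close>
  define t where "t n = real (Suc n)" for n
  define e where "e n = inverse (t n)" for n
  define z where "z n = u + (e n)\<^sup>2 *\<^sub>R w" for n
  define x where "x n = t n *\<^sub>R z n" for n
  have t_pos: "t n > 0" for n by (simp add: t_def)
  have t_top: "filterlim t at_top sequentially"
    unfolding t_def using filterlim_real_sequentially filterlim_sequentially_Suc by blast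
  have e0: "e \<longlonglongrightarrow> 0"
    unfolding e_def by (rule tendsto_inverse_0_at_top[OF t_top])
  have "z \<longlonglongrightarrow> u + 0\<^sup>2 *\<^sub>R w"
    unfolding z_def by (intro tendsto_intros e0)
  then have z: "z \<longlonglongrightarrow> u" by simp
  have norm_x: "norm (x n) = norm (z n) * t n" for n
    using t_pos[of n] by (simp add: x_def)
  have "x n \<in> V" for n
    using V uV wV by (simp add: x_def z_def subspace_scale subspace_add)
  moreover have "filterlim (\<lambda>n. norm (x n)) at_top sequentially"
    unfolding norm_x
    by (rule filterlim_tendsto_pos_mult_at_top[OF tendsto_norm[OF z] _ t_top]) (use u in simp)
  moreover have "(\<lambda>n. x n /\<^sub>R norm (x n)) \<longlonglongrightarrow> u /\<^sub>R norm u"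
  proof -
    have "x n /\<^sub>R norm (x n) = z n /\<^sub>R norm (z n)" for n
      using t_pos[of n] by (simp add: x_def)
    then show ?thesis
      using u by (auto intro!: tendsto_intros z)
  qed
  moreover have "bounded (range (\<lambda>n. F_hat A (x n)))"
  proof (rule convergent_imp_bounded)
    have "F_hat A (x n) = e n *\<^sub>R w + (3 * e n) *\<^sub>R (A *v (u * w ^ 2)) + (e n ^ 3) *\<^sub>R (A *v (w ^ 3))" for n
    proof -
      have te: "t n * e n = 1" using t_pos[of n] by (simp add: e_def)
      have x: "x n = t n *\<^sub>R u + e n *\<^sub>R w"
        using t_pos[of n] by (simp add: x_def z_def e_def scaleR_add_right power2_eq_square)
      \<comment> \<open>The products \<open>t n * e n\<close> stay unreduced so that this is a
        polynomial identity; \<open>te\<close> collapses them afterwards.\<close>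
      have "x n ^ 3 = (t n ^ 3) *\<^sub>R u ^ 3 + (t n * (t n * e n)) *\<^sub>R (3 *\<^sub>R (w * u ^ 2))
          + (3 * (t n * e n) * e n) *\<^sub>R (u * w ^ 2) + (e n ^ 3) *\<^sub>R w ^ 3"
        by (simp add: x vec_eq_iff vec_power_component eval_nat_numeral algebra_simps)
      then have "A *v (x n ^ 3) = t n *\<^sub>R (- u) + (3 * e n) *\<^sub>R (A *v (u * w ^ 2)) + (e n ^ 3) *\<^sub>R (A *v (w ^ 3))"
        unfolding te by (simp only: matrix_vector_right_distrib matrix_vector_mult_scaleR ker Aw) simp
      then show ?thesis by (simp add: F_hat_def x)
    qed
    moreover have "(\<lambda>n. e n *\<^sub>R w + (3 * e n) *\<^sub>R (A *v (u * w ^ 2)) + (e n ^ 3) *\<^sub>R (A *v (w ^ 3)))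
        \<longlonglongrightarrow> 0 *\<^sub>R w + (3 * 0) *\<^sub>R (A *v (u * w ^ 2)) + (0 ^ 3) *\<^sub>R (A *v (w ^ 3))"
      by (intro tendsto_intros e0)
    ultimately show "(\<lambda>n. F_hat A (x n)) \<longlonglongrightarrow> 0" by simp
  qed
  ultimately show ?thesis by blast
qed

theorem theorem1p10:
  fixes A :: "real ^ 'n ^ 'n" and V :: "(real ^ 'n) set" and x_inf :: "real ^ 'n"
  assumes "subspace V"
    and "cube_root_set (Ker A) \<subseteq> V"
    and "x_inf \<in> V"
    and "\<forall>i. x_inf $ i \<noteq> 0"
  shows "(\<exists>x :: nat \<Rightarrow> real ^ 'n.
            (\<forall>n. x n \<in> V)
          \<and> filterlim (\<lambda>n. norm (x n)) at_top sequentially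
          \<and> bounded (range (\<lambda>n. F_hat A (x n)))
          \<and> (\<lambda>n. x n /\<^sub>R norm (x n)) \<longlonglongrightarrow> x_inf /\<^sub>R norm x_inf)
     \<longleftrightarrow> x_inf \<in> ((*v) A) ` mult_set V (x_inf ^ 2) \<inter> cube_root_set (Ker A)"
  (is "?seq \<longleftrightarrow> _")
proof
  have nz: "norm x_inf \<noteq> 0"
    using assms(4) by (auto simp: vec_eq_iff)
  show "x_inf \<in> ((*v) A) ` mult_set V (x_inf ^ 2) \<inter> cube_root_set (Ker A)" if seq: ?seq
  proof -
    let ?c = "inverse (norm x_inf)"
    obtain x :: "nat \<Rightarrow> real ^ 'n" where x: "\<And>n. x n \<in> V"
        "filterlim (\<lambda>n. norm (x n)) at_top sequentially"
        "bounded (range (\<lambda>n. F_hat A (x n)))"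
        "(\<lambda>n. x n /\<^sub>R norm (x n)) \<longlonglongrightarrow> ?c *\<^sub>R x_inf"
      using seq by blast
    have c_nz: "(?c *\<^sub>R x_inf) $ i \<noteq> 0" for i
      using assms(4) nz by simp
    note lim = escaping_sequence_limit[OF assms(1,2) c_nz x]
    have "A *v (x_inf ^ 3) = 0"
      using lim(1) nz by (simp add: scaleR_vec_power matrix_vector_mult_scaleR)
    moreover obtain w where "w \<in> V" "A *v (w * (?c *\<^sub>R x_inf) ^ 2) = (- ?c) *\<^sub>R x_inf"
      using lim(2) by auto
    then have "x_inf \<in> ((*v) A) ` mult_set V (x_inf ^ 2)"
      using mem_image_mult_set_scaleR[OF assms(1)] nz
      by (metis inverse_nonzero_iff_nonzero neg_equal_0_iff_equal)
    ultimately show ?thesis by (simp add: cube_root_set_def Ker_def)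
  qed
  show ?seq if "x_inf \<in> ((*v) A) ` mult_set V (x_inf ^ 2) \<inter> cube_root_set (Ker A)"
  proof -
    from that obtain v where v: "v \<in> V" "A *v (v * x_inf ^ 2) = x_inf"
      and ker: "A *v (x_inf ^ 3) = 0"
      by (auto simp: mult_set_def cube_root_set_def Ker_def)
    \<comment> \<open>The factor \<open>- 1 / 3\<close> offsets the binomial coefficient 3 and makes
      the linear term of the cube cancel the identity part of \<open>F_hat\<close>.\<close>
    have "(- (1 / 3) *\<^sub>R v) * x_inf ^ 2 = - (1 / 3) *\<^sub>R (v * x_inf ^ 2)"
      by (simp add: vec_eq_iff)
    then have "3 *\<^sub>R (A *v ((- (1 / 3) *\<^sub>R v) * x_inf ^ 2)) = - x_inf"
      by (simp only: matrix_vector_mult_scaleR v(2)) simp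
    moreover have "- (1 / 3) *\<^sub>R v \<in> V"
      using assms(1) v(1) subspace_scale by blast
    ultimately show ?seq
      using escaping_sequence_exists[OF assms(1,3) _ _ ker] nz by auto
  qed
qed

end
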